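(* (i) For any non-prime integer $n>1$, $$\sum_{\substack{A\subseteq L_n\setminus\{1,n\}\\ \gcd(A)=1}}(-1)^{|A|}=\sum_{\substack{A\subseteq P_n^\ast\\ \gcd(A)=1}}(-1)^{|A|}=\sum_{\substack{A\subseteq P_n\\ \gcd(A^\ast)=1}}(-1)^{|A|}=\sum_{\substack{A\subseteq P_n\\ \operatorname{lcm}(A)=n}}(-1)^{|A|}=\mu(n).$$ (ii) For any non-prime integer $n\ge 1$, $$\sum_{\substack{A\subseteq L_n\setminus\{1,n\}\\ \operatorname{lcm}(A)=n}}(-1)^{|A|}=\sum_{\substack{A\subseteq P_n\\ \operatorname{lcm}(A)=n}}(-1)^{|A|}=\sum_{\substack{A\subseteq P_n\\ \gcd(A^\ast)=1}}(-1)^{|A|}=\sum_{\substack{A\subseteq P_n^\ast\\ \gcd(A)=1}}(-1)^{|A|}=\mu(n).$$ (iii) The requirement that $n$ is non-prime can be omitted in (i) if $L_n\setminus\{1,n\}$ is replaced by $L_n\setminus\{n\}$, and in (ii) if $L_n\setminus\{1,n\}$ is replaced by $L_n\setminus\{1\}$.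
   Context: For a positive integer $n$, $L_n$ denotes the set (lattice) of positive divisors of $n$, $P_n$ the set of prime factors of $n$, $A^\ast=\{n/a\mid a\in A\}$ for $A\subseteq P_n$ (so $P_n^\ast=\{n/p\mid p\in P_n\}$), and $\mu$ is the classical (number-theoretic) Möbius function, i.e. $\mu(n)=(-1)^k$ if $n$ is the product of $k\ge 0$ distinct primes, and $\mu(n)=0$ otherwise. $\gcd(A)$ and $\operatorname{lcm}(A)$ denote the greatest common divisor and least common multiple of the finite set $A$ of positive integers, with the conventions $\gcd(\emptyset)=0$ and $\operatorname{lcm}(\emptyset)=1$.
   Formalization: In (ii) and its half of (iii), equalities involving the two sums with a gcd condition are claimed only for n ≠ 1: at n = 1 the only set is empty, gcd(∅)=0, so both sums are 0 while μ(1)=1; the lcm-sum equalities with μ(n) are kept at n = 1. *)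

theory Defs
  imports "HOL-Computational_Algebra.Primes"
begin

definition divisors :: "nat \<Rightarrow> nat set" where
  "divisors n = {d. d dvd n}"

text \<open>The set \<open>A\<^sup>*\<close> of the complementary divisors; it is only used for sets \<open>A\<close> of
  divisors of \<open>n\<close>, so the integer division is exact.\<close>

definition codivisors :: "nat \<Rightarrow> nat set \<Rightarrow> nat set" where
  "codivisors n A = (\<lambda>a. n div a) ` A"

text \<open>If \<open>n\<close> is the product of a finite set \<open>P\<close> of primes, then \<open>P\<close> is necessarily the set of
  prime factors of \<open>n\<close>; see \<open>moebius_prod_primes\<close> below.\<close>

definition moebius :: "nat \<Rightarrow> int" where
  "moebius n =
     (if \<exists>P. finite P \<and> (\<forall>p\<in>P. prime p) \<and> n = \<Prod>P
      then (-1) ^ card (prime_factors n) else 0)"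

lemma prime_factors_prod_primes:
  fixes P :: "nat set"
  assumes "finite P" and "\<forall>p\<in>P. prime p"
  shows "prime_factors (\<Prod>P) = P"
proof -
  have "0 \<notin> id ` P" using assms(2) by auto
  then have "prime_factors (prod id P) = \<Union>((prime_factors \<circ> id) ` P)"
    using assms(1) by (intro prime_factors_prod) auto
  then show ?thesis
    using assms(2) by (auto simp: prime_prime_factors)
qed

lemma moebius_prod_primes:
  fixes P :: "nat set"
  assumes "finite P" and "\<forall>p\<in>P. prime p"
  shows "moebius (\<Prod>P) = (-1) ^ card P"
  using assms prime_factors_prod_primes[OF assms] by (auto simp: moebius_def)

text \<open>Since \<open>Gcd {} = 0\<close>, the two sums over sets with greatest common divisor 1 are empty at
  \<open>n = 1\<close> and do not equal \<open>moebius 1\<close>; equalities involving them need \<open>n \<noteq> 1\<close>.\<close>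

lemma gcd_sums_at_1:
  "(\<Sum>A | A \<subseteq> prime_factors (1::nat) \<and> Gcd (codivisors 1 A) = 1. (-1 :: int) ^ card A) = 0"
  "(\<Sum>A | A \<subseteq> codivisors 1 (prime_factors (1::nat)) \<and> Gcd A = 1. (-1 :: int) ^ card A) = 0"
  "moebius 1 = 1"
  using moebius_prod_primes[of "{}"]
  by (auto simp: codivisors_def intro!: sum.neutral)

end

theory Submission
  imports Defs
begin

text \<open>
  All the sums are instances of the crosscut principle. Suppose that a set \<open>A\<close> contains \<open>x\<close>, and let
  \<open>p\<close> be a proper divisor of \<open>x\<close>. Then putting \<open>p\<close> into \<open>A\<close> or taking it out does not affect
  \<open>Lcm A\<close>, but it reverses the sign \<open>(-1) ^ card A\<close>; so the sets that contain \<open>x\<close> cancel in pairs,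
  and \<open>x\<close> may be dropped from the ground set as long as \<open>p\<close> remains. Starting from the divisors of
  \<open>n\<close> other than 1, this drops everything but the prime factors. Dually, a multiple of \<open>x\<close> does not
  affect \<open>Gcd A\<close>, and the divisors other than \<open>n\<close> are reduced to the maximal ones \<open>n / p\<close>
  (\<open>sum_sign_crosscut\<close>). When \<open>n\<close> is not prime, no prime factor equals \<open>n\<close> and no \<open>n / p\<close> equals 1,
  so the ground set may omit both 1 and \<open>n\<close>.

  Complementation \<open>a \<mapsto> n / a\<close> exchanges the two reduced sums, since it turns \<open>Lcm A = n\<close> into
  \<open>Gcd A\<^sup>* = 1\<close>. Finally, the least common multiple of a set \<open>A\<close> of primes is their product, so it
  equals \<open>n\<close> only if \<open>A\<close> consists of all prime factors of \<open>n\<close> and \<open>n\<close> is squarefree: the remaining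
  sum has at most one term, and that term is the Moebius function.
\<close>

section \<open>The crosscut principle\<close>

text \<open>Adding or removing \<open>p\<close> is a sign-reversing involution on the index set: because \<open>p \<noteq> x\<close>, it keeps
  \<open>x\<close> in \<open>A\<close>, which makes the condition \<open>Q\<close> blind to \<open>p\<close>.\<close>

lemma sum_sign_toggle_eq_0:
  assumes "finite X" and "p \<in> X" and "p \<noteq> x"
    and "\<And>A. A \<subseteq> X \<Longrightarrow> x \<in> A \<Longrightarrow> Q (insert p A) \<longleftrightarrow> Q A"
  shows "(\<Sum>A | A \<subseteq> X \<and> x \<in> A \<and> Q A. (-1 :: int) ^ card A) = 0"
proof -
  let ?S = "{A. A \<subseteq> X \<and> x \<in> A \<and> Q A}"
  define t where "t A = (if p \<in> A then A - {p} else insert p A)" for A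
  have t_in: "t A \<in> ?S" if "A \<in> ?S" for A
    using that assms(2,3) assms(4)[of A] assms(4)[of "A - {p}"]
    by (auto simp: t_def insert_absorb)
  have t_t: "t (t A) = A" for A
    by (auto simp: t_def)
  have sign: "(-1 :: int) ^ card (t A) = - ((-1) ^ card A)" if "A \<in> ?S" for A
  proof -
    from that assms(1) have "finite A"
      by (auto intro: finite_subset)
    then show ?thesis
      by (cases "p \<in> A") (simp_all add: t_def card.remove[of A p] del: card_Diff_insert)
  qed
  have "(\<Sum>A\<in>?S. (-1 :: int) ^ card A) = (\<Sum>A\<in>?S. - ((-1) ^ card A))"
    by (rule sum.reindex_bij_witness[of _ t t]) (use t_in t_t sign in auto)
  then show ?thesis
    by (simp add: sum_negf)
qed

text \<open>The abstract form of the reduction covers both lattice operations: \<open>Q A\<close> will be \<open>Lcm A = n\<close>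
  or \<open>Gcd A = 1\<close>, and the element \<open>p\<close> that \<open>x\<close> makes irrelevant lies below or above \<open>x\<close>.\<close>

lemma sum_sign_crosscut:
  assumes "finite X" and "P \<subseteq> X"
    and irrel: "\<And>x. x \<in> X - P \<Longrightarrow> \<exists>p\<in>P. \<forall>A\<subseteq>X. x \<in> A \<longrightarrow> (Q (insert p A) \<longleftrightarrow> Q A)"
  shows "(\<Sum>A | A \<subseteq> X \<and> Q A. (-1 :: int) ^ card A) = (\<Sum>A | A \<subseteq> P \<and> Q A. (-1) ^ card A)"
proof -
  have "(\<Sum>A | A \<subseteq> P \<union> D \<and> Q A. (-1 :: int) ^ card A) = (\<Sum>A | A \<subseteq> P \<and> Q A. (-1) ^ card A)"
    if "finite D" and "D \<subseteq> X - P" for D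
    using that
  proof (induction D rule: finite_induct)
    case empty
    show ?case by simp
  next
    case (insert x D)
    let ?Y = "P \<union> insert x D"
    have Y: "?Y \<subseteq> X" "finite ?Y"
      using insert.prems assms(1,2) by (auto intro: finite_subset)
    obtain p where p: "p \<in> P" "\<forall>A\<subseteq>X. x \<in> A \<longrightarrow> (Q (insert p A) \<longleftrightarrow> Q A)"
      using irrel[of x] insert.prems by blast
    have "{A. A \<subseteq> ?Y \<and> Q A} = {A. A \<subseteq> P \<union> D \<and> Q A} \<union> {A. A \<subseteq> ?Y \<and> x \<in> A \<and> Q A}"
      by auto
    moreover have "{A. A \<subseteq> P \<union> D \<and> Q A} \<inter> {A. A \<subseteq> ?Y \<and> x \<in> A \<and> Q A} = {}"
      using insert.hyps insert.prems by auto
    ultimately have split: "(\<Sum>A | A \<subseteq> ?Y \<and> Q A. (-1 :: int) ^ card A)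
        = (\<Sum>A | A \<subseteq> P \<union> D \<and> Q A. (-1) ^ card A)
          + (\<Sum>A | A \<subseteq> ?Y \<and> x \<in> A \<and> Q A. (-1) ^ card A)"
      using Y(2) by (simp add: sum.union_disjoint)
    have "(\<Sum>A | A \<subseteq> ?Y \<and> x \<in> A \<and> Q A. (-1 :: int) ^ card A) = 0"
    proof (rule sum_sign_toggle_eq_0)
      show "finite ?Y" "p \<in> ?Y" "p \<noteq> x"
        using Y(2) p(1) insert.prems by auto
      show "Q (insert p A) \<longleftrightarrow> Q A" if "A \<subseteq> ?Y" "x \<in> A" for A
        using p(2) that Y(1) by (meson subset_trans)
    qed
    with split show ?case
      using insert.IH insert.prems by simp
  qed
  from this[of "X - P"] show ?thesis
    using assms(1,2) by (simp add: Un_absorb1)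
qed

section \<open>Reduction to prime factors and to their complementary divisors\<close>

lemma finite_divisors: "n > 0 \<Longrightarrow> finite (divisors n)"
  by (simp add: divisors_def)

lemma sum_sign_Lcm_prime_factors:
  assumes "n > 0" and "prime_factors n \<subseteq> X" and "X \<subseteq> divisors n - {1}"
  shows "(\<Sum>A | A \<subseteq> X \<and> Lcm A = n. (-1 :: int) ^ card A)
    = (\<Sum>A | A \<subseteq> prime_factors n \<and> Lcm A = n. (-1) ^ card A)"
proof (rule sum_sign_crosscut)
  show "finite X"
    using assms(1,3) finite_divisors by (auto intro: finite_subset)
  fix x assume "x \<in> X - prime_factors n"
  then have x: "x dvd n" "x \<noteq> 1"
    using assms(3) by (auto simp: divisors_def)
  then obtain p where p: "prime p" "p dvd x"
    using prime_factor_nat by blast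
  have irrel: "Lcm (insert p A) = Lcm A" if "x \<in> A" for A
  proof -
    have "p dvd Lcm A"
      using p(2) that by (meson dvd_Lcm dvd_trans)
    then show ?thesis
      by simp
  qed
  have mem: "p \<in> prime_factors n"
    using p x assms(1) by (auto simp: prime_factors_dvd intro: dvd_trans)
  show "\<exists>p\<in>prime_factors n. \<forall>A\<subseteq>X. x \<in> A \<longrightarrow> (Lcm (insert p A) = n \<longleftrightarrow> Lcm A = n)"
    by (intro bexI[OF _ mem] allI impI) (simp only: irrel)
qed (rule assms(2))

lemma sum_sign_Gcd_codivisors:
  assumes "n > 0" and "codivisors n (prime_factors n) \<subseteq> X" and "X \<subseteq> divisors n - {n}"
  shows "(\<Sum>A | A \<subseteq> X \<and> Gcd A = 1. (-1 :: int) ^ card A)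
    = (\<Sum>A | A \<subseteq> codivisors n (prime_factors n) \<and> Gcd A = 1. (-1) ^ card A)"
proof (rule sum_sign_crosscut)
  show "finite X"
    using assms(1,3) finite_divisors by (auto intro: finite_subset)
  fix x assume "x \<in> X - codivisors n (prime_factors n)"
  then have "x dvd n" and "x \<noteq> n"
    using assms(3) by (auto simp: divisors_def)
  from \<open>x dvd n\<close> obtain y where y: "n = x * y" ..
  \<comment> \<open>Any prime divisor \<open>p\<close> of the cofactor \<open>y\<close> of \<open>x\<close> leaves \<open>x\<close> a divisor of \<open>n / p\<close>.\<close>
  with \<open>x \<noteq> n\<close> have "y \<noteq> 1"
    by auto
  then obtain p where p: "prime p" "p dvd y"
    using prime_factor_nat by blast
  then have "x dvd n div p"
    using y by (metis div_mult_swap dvd_triv_left)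
  then have irrel: "Gcd (insert (n div p) A) = Gcd A" if "x \<in> A" for A
  proof -
    have "Gcd A dvd n div p"
      using \<open>x dvd n div p\<close> that by (meson Gcd_dvd dvd_trans)
    then show ?thesis
      by simp
  qed
  have mem: "n div p \<in> codivisors n (prime_factors n)"
    using p y assms(1) by (auto simp: codivisors_def prime_factors_dvd)
  show "\<exists>q\<in>codivisors n (prime_factors n).
      \<forall>A\<subseteq>X. x \<in> A \<longrightarrow> (Gcd (insert q A) = 1 \<longleftrightarrow> Gcd A = 1)"
    by (intro bexI[OF _ mem] allI impI) (simp only: irrel)
qed (rule assms(2))

section \<open>Complementation\<close>

lemma inj_on_div_divisors:
  assumes "n > 0"
  shows "inj_on (\<lambda>a. n div a) (divisors n)"
  by (rule inj_on_inverseI[of _ "\<lambda>a. n div a"]) (use assms in \<open>auto simp: divisors_def\<close>)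

text \<open>Complementation reverses divisibility among the divisors of \<open>n\<close>, so it turns the least common
  multiple \<open>l\<close> of \<open>A\<close> into the greatest common divisor \<open>n / l\<close> of \<open>A\<^sup>*\<close>. The empty set
  is the exception, \<open>Gcd {}\<close> being 0 rather than \<open>n\<close>; its least common multiple is 1, which is why the
  equivalence needs \<open>n > 1\<close>.\<close>

lemma Gcd_codivisors_eq_1_iff:
  assumes "n > 1" and "A \<subseteq> divisors n"
  shows "Gcd (codivisors n A) = 1 \<longleftrightarrow> Lcm A = n"
proof
  have A: "a dvd n" if "a \<in> A" for a
    using that assms(2) by (auto simp: divisors_def)
  then have "Lcm A dvd n"
    by (auto intro: Lcm_least)
  then obtain k where k: "n = Lcm A * k" ..
  assume gcd: "Gcd (codivisors n A) = 1"
  have "k dvd n div a" if "a \<in> A" for a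
    using k that assms(1) dvd_Lcm[OF that] A[OF that]
    by (metis div_mult_swap dvd_triv_right mult.commute)
  then have "k dvd Gcd (codivisors n A)"
    by (auto simp: codivisors_def intro!: Gcd_greatest)
  with gcd k show "Lcm A = n"
    by simp
next
  assume lcm: "Lcm A = n"
  define g where "g = Gcd (codivisors n A)"
  obtain a where "a \<in> A"
    using lcm assms(1) by (cases "A = {}") auto
  have A: "g * a dvd n" if "a \<in> A" for a
  proof -
    have "g dvd n div a"
      using that by (auto simp: g_def codivisors_def intro: Gcd_dvd)
    moreover have "a dvd n"
      using that assms(2) by (auto simp: divisors_def)
    ultimately show ?thesis
      by (metis dvd_div_mult_self mult_dvd_mono dvd_refl)
  qed
  then have "g dvd n"
    using \<open>a \<in> A\<close> dvd_mult_left by blast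
  then obtain m where m: "n = g * m" ..
  then have "g > 0"
    using assms(1) by (cases g) auto
  then have "Lcm A dvd m"
    using A m by (auto intro!: Lcm_least)
  with lcm m assms(1) show "Gcd (codivisors n A) = 1"
    using g_def by (metis dvd_antisym dvd_triv_right mult_eq_self_implies_10 mult.commute not_less_zero)
qed

lemma prime_factors_subset_divisors: "prime_factors n \<subseteq> divisors n"
  by (auto simp: divisors_def)

lemma sum_sign_codivisors:
  assumes "n > 0" and "P \<subseteq> divisors n"
  shows "(\<Sum>A | A \<subseteq> codivisors n P \<and> Q A. (-1 :: int) ^ card A)
    = (\<Sum>A | A \<subseteq> P \<and> Q (codivisors n A). (-1) ^ card A)"
proof -
  have inj: "inj_on (\<lambda>a. n div a) P"
    using inj_on_div_divisors[OF assms(1)] assms(2) by (rule inj_on_subset)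
  have "inj_on (codivisors n) {A. A \<subseteq> P \<and> Q (codivisors n A)}"
    using inj_on_image_Pow[OF inj] by (auto simp: inj_on_def codivisors_def)
  moreover have "codivisors n ` {A. A \<subseteq> P \<and> Q (codivisors n A)} = {A. A \<subseteq> codivisors n P \<and> Q A}"
    by (auto simp: codivisors_def subset_image_iff)
  moreover have "card (codivisors n A) = card A" if "A \<subseteq> P" for A
    using inj_on_subset[OF inj that] by (simp add: codivisors_def card_image)
  ultimately show ?thesis
    by (intro sum.reindex_cong[of "codivisors n"]) auto
qed

section \<open>The Moebius function as the surviving term\<close>

lemma Lcm_primes_eq_prod:
  fixes A :: "nat set"
  assumes "finite A" and "\<forall>p\<in>A. prime p"
  shows "Lcm A = \<Prod>A"
  using assms
proof (induction A rule: finite_induct)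
  case empty
  show ?case by simp
next
  case (insert p A)
  then have "coprime p (\<Prod>A)"
    by (auto intro!: prod_coprime_right primes_coprime)
  with insert show ?case
    by (simp add: lcm_coprime)
qed

lemma sum_sign_Lcm_prime_factors_eq_moebius:
  "(\<Sum>A | A \<subseteq> prime_factors n \<and> Lcm A = n. (-1 :: int) ^ card A) = moebius n"
proof -
  let ?P = "prime_factors n"
  have primes: "finite A" "\<forall>p\<in>A. prime p" if "A \<subseteq> ?P" for A
    using that by (auto intro: finite_subset)
  have all: "A = ?P" if "A \<subseteq> ?P" and "Lcm A = n" for A
    using that primes[OF that(1)] prime_factors_prod_primes Lcm_primes_eq_prod by metis
  show ?thesis
  proof (cases "Lcm ?P = n")
    case True
    then have "{A. A \<subseteq> ?P \<and> Lcm A = n} = {?P}"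
      using all by auto
    moreover have "\<Prod>?P = n"
      using True Lcm_primes_eq_prod[OF primes[OF subset_refl]] by simp
    then have "moebius n = (-1) ^ card ?P"
      using moebius_prod_primes[OF primes[OF subset_refl]] by simp
    ultimately show ?thesis
      by simp
  next
    case False
    have "{A. A \<subseteq> ?P \<and> Lcm A = n} = {}"
      using all False by (metis (mono_tags, lifting) empty_Collect_eq)
    moreover have "n \<noteq> \<Prod>P" if "finite P" "\<forall>p\<in>P. prime p" for P
      using that False prime_factors_prod_primes[OF that] Lcm_primes_eq_prod[OF that] by auto
    then have "moebius n = 0"
      by (auto simp: moebius_def)
    ultimately show ?thesis
      by (metis sum.empty)
  qed
qed

theorem mainTheorem7:
    "(\<forall>n::nat. n > 1 \<and> \<not> prime n \<longrightarrow>
       (\<Sum>A | A \<subseteq> divisors n - {1, n} \<and> Gcd A = 1. (-1 :: int) ^ card A)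
         = (\<Sum>A | A \<subseteq> codivisors n (prime_factors n) \<and> Gcd A = 1. (-1 :: int) ^ card A) \<and>
       (\<Sum>A | A \<subseteq> codivisors n (prime_factors n) \<and> Gcd A = 1. (-1 :: int) ^ card A)
         = (\<Sum>A | A \<subseteq> prime_factors n \<and> Gcd (codivisors n A) = 1. (-1 :: int) ^ card A) \<and>
       (\<Sum>A | A \<subseteq> prime_factors n \<and> Gcd (codivisors n A) = 1. (-1 :: int) ^ card A)
         = (\<Sum>A | A \<subseteq> prime_factors n \<and> Lcm A = n. (-1 :: int) ^ card A) \<and>
       (\<Sum>A | A \<subseteq> prime_factors n \<and> Lcm A = n. (-1 :: int) ^ card A)
         = moebius n) \<and>
     (\<forall>n::nat. n \<ge> 1 \<and> \<not> prime n \<longrightarrow>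
       (\<Sum>A | A \<subseteq> divisors n - {1, n} \<and> Lcm A = n. (-1 :: int) ^ card A)
         = (\<Sum>A | A \<subseteq> prime_factors n \<and> Lcm A = n. (-1 :: int) ^ card A) \<and>
       (\<Sum>A | A \<subseteq> prime_factors n \<and> Lcm A = n. (-1 :: int) ^ card A)
         = moebius n \<and>
       (n \<noteq> 1 \<longrightarrow>
         (\<Sum>A | A \<subseteq> prime_factors n \<and> Lcm A = n. (-1 :: int) ^ card A)
           = (\<Sum>A | A \<subseteq> prime_factors n \<and> Gcd (codivisors n A) = 1. (-1 :: int) ^ card A) \<and>
         (\<Sum>A | A \<subseteq> prime_factors n \<and> Gcd (codivisors n A) = 1. (-1 :: int) ^ card A)
           = (\<Sum>A | A \<subseteq> codivisors n (prime_factors n) \<and> Gcd A = 1. (-1 :: int) ^ card A) \<and>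
         (\<Sum>A | A \<subseteq> codivisors n (prime_factors n) \<and> Gcd A = 1. (-1 :: int) ^ card A)
           = moebius n)) \<and>
     (\<forall>n::nat. n > 1 \<longrightarrow>
       (\<Sum>A | A \<subseteq> divisors n - {n} \<and> Gcd A = 1. (-1 :: int) ^ card A)
         = (\<Sum>A | A \<subseteq> codivisors n (prime_factors n) \<and> Gcd A = 1. (-1 :: int) ^ card A) \<and>
       (\<Sum>A | A \<subseteq> codivisors n (prime_factors n) \<and> Gcd A = 1. (-1 :: int) ^ card A)
         = (\<Sum>A | A \<subseteq> prime_factors n \<and> Gcd (codivisors n A) = 1. (-1 :: int) ^ card A) \<and>
       (\<Sum>A | A \<subseteq> prime_factors n \<and> Gcd (codivisors n A) = 1. (-1 :: int) ^ card A)
         = (\<Sum>A | A \<subseteq> prime_factors n \<and> Lcm A = n. (-1 :: int) ^ card A) \<and>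
       (\<Sum>A | A \<subseteq> prime_factors n \<and> Lcm A = n. (-1 :: int) ^ card A)
         = moebius n) \<and>
     (\<forall>n::nat. n \<ge> 1 \<longrightarrow>
       (\<Sum>A | A \<subseteq> divisors n - {1} \<and> Lcm A = n. (-1 :: int) ^ card A)
         = (\<Sum>A | A \<subseteq> prime_factors n \<and> Lcm A = n. (-1 :: int) ^ card A) \<and>
       (\<Sum>A | A \<subseteq> prime_factors n \<and> Lcm A = n. (-1 :: int) ^ card A)
         = moebius n \<and>
       (n \<noteq> 1 \<longrightarrow>
         (\<Sum>A | A \<subseteq> prime_factors n \<and> Lcm A = n. (-1 :: int) ^ card A)
           = (\<Sum>A | A \<subseteq> prime_factors n \<and> Gcd (codivisors n A) = 1. (-1 :: int) ^ card A) \<and>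
         (\<Sum>A | A \<subseteq> prime_factors n \<and> Gcd (codivisors n A) = 1. (-1 :: int) ^ card A)
           = (\<Sum>A | A \<subseteq> codivisors n (prime_factors n) \<and> Gcd A = 1. (-1 :: int) ^ card A) \<and>
         (\<Sum>A | A \<subseteq> codivisors n (prime_factors n) \<and> Gcd A = 1. (-1 :: int) ^ card A)
           = moebius n))"
proof -
  let ?sum = "\<lambda>Q. (\<Sum>A | Q A. (-1 :: int) ^ card A)"
  have prime_factors_sub: "prime_factors n \<subseteq> divisors n - {1}" for n :: nat
    by (auto simp: divisors_def in_prime_factors_iff)
  have codivisors_sub: "codivisors n (prime_factors n) \<subseteq> divisors n - {n}" if "n > 1" for n :: nat
  proof -
    have "n div p dvd n \<and> n div p \<noteq> n" if "p \<in> prime_factors n" for p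
    proof -
      have "p dvd n" "p > 1"
        using that prime_gt_1_nat[of p] by (auto simp: in_prime_factors_iff)
      with \<open>n > 1\<close> show ?thesis
        by (auto simp: div_dvd_iff_mult)
    qed
    then show ?thesis
      by (auto simp: codivisors_def divisors_def)
  qed
  have prime_factors_sub': "prime_factors n \<subseteq> divisors n - {1, n}" if "\<not> prime n" for n :: nat
    using that prime_factors_sub[of n] by auto
  have codivisors_sub': "codivisors n (prime_factors n) \<subseteq> divisors n - {1, n}"
    if "n > 1" "\<not> prime n" for n :: nat
  proof -
    have "n div p \<noteq> 1" if "p \<in> prime_factors n" for p
    proof
      assume "n div p = 1"
      then have "n = p"
        using that by (metis dvd_div_mult_self in_prime_factors_iff mult_1)
      with that \<open>\<not> prime n\<close> show False
        by auto
    qed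
    with codivisors_sub[OF that(1)] show ?thesis
      by (auto simp: codivisors_def)
  qed
  have Gcd_codivisors: "?sum (\<lambda>A. A \<subseteq> prime_factors n \<and> Gcd (codivisors n A) = 1) = moebius n"
    if "n > 1" for n
  proof -
    have "{A. A \<subseteq> prime_factors n \<and> Gcd (codivisors n A) = 1}
        = {A. A \<subseteq> prime_factors n \<and> Lcm A = n}"
      by (intro Collect_cong conj_cong refl Gcd_codivisors_eq_1_iff[OF that])
        (rule subset_trans[OF _ prime_factors_subset_divisors])
    then show ?thesis
      by (simp only: sum_sign_Lcm_prime_factors_eq_moebius)
  qed
  have codivisors_Gcd: "?sum (\<lambda>A. A \<subseteq> codivisors n (prime_factors n) \<and> Gcd A = 1) = moebius n"
    if "n > 1" for n
  proof -
    have "n > 0"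
      using that by simp
    from sum_sign_codivisors[OF this prime_factors_subset_divisors, of "\<lambda>A. Gcd A = 1"]
    show ?thesis
      by (simp only: Gcd_codivisors[OF that])
  qed
  have Lcm_sum: "?sum (\<lambda>A. A \<subseteq> X \<and> Lcm A = n) = moebius n"
    if "n \<ge> 1" "prime_factors n \<subseteq> X" "X \<subseteq> divisors n - {1}" for n X
    using sum_sign_Lcm_prime_factors[OF _ that(2,3)] that(1)
    by (simp add: sum_sign_Lcm_prime_factors_eq_moebius)
  have Gcd_sum: "?sum (\<lambda>A. A \<subseteq> X \<and> Gcd A = 1) = moebius n"
    if "n > 1" "codivisors n (prime_factors n) \<subseteq> X" "X \<subseteq> divisors n - {n}" for n X
  proof -
    have "n > 0"
      using that(1) by simp
    from sum_sign_Gcd_codivisors[OF this that(2,3)] codivisors_Gcd[OF that(1)] show ?thesis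
      by (rule trans)
  qed
  have Lcm_X: "?sum (\<lambda>A. A \<subseteq> divisors n - {1} \<and> Lcm A = n) = moebius n" if "n \<ge> 1" for n
    by (rule Lcm_sum[OF that prime_factors_sub subset_refl])
  have Lcm_X': "?sum (\<lambda>A. A \<subseteq> divisors n - {1, n} \<and> Lcm A = n) = moebius n"
    if "n \<ge> 1" "\<not> prime n" for n
    by (rule Lcm_sum[OF that(1) prime_factors_sub'[OF that(2)]]) auto
  have Gcd_X: "?sum (\<lambda>A. A \<subseteq> divisors n - {n} \<and> Gcd A = 1) = moebius n" if "n > 1" for n
    by (rule Gcd_sum[OF that codivisors_sub[OF that] subset_refl])
  have Gcd_X': "?sum (\<lambda>A. A \<subseteq> divisors n - {1, n} \<and> Gcd A = 1) = moebius n"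
    if "n > 1" "\<not> prime n" for n
    by (rule Gcd_sum[OF that(1) codivisors_sub'[OF that]]) auto
  have gt_1: "n > 1" if "n \<ge> 1" "n \<noteq> 1" for n :: nat
    using that by simp
  show ?thesis
    by (intro conjI allI impI; (elim conjE)?;
        simp only: Lcm_X Lcm_X' Gcd_X Gcd_X' Gcd_codivisors codivisors_Gcd gt_1
          sum_sign_Lcm_prime_factors_eq_moebius simp_thms)
qed

end
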